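(* Let $f:\mathbb{N}\to\mathbb{N}$ satisfy $f(s)=0$ for all but finitely many $s\in\mathbb{N}$, and let $M=\sum_{s\ge 0}f(s)$. Then for all integers $k>0$, $$\sum_{n\ge 0}\binom{k}{n}_{f} \equiv M\pmod{2}.$$
   Context: $\mathbb{N}=\{0,1,2,\dots\}$. For a function $f:\mathbb{N}\to\mathbb{N}$ and integers $k,n\ge 0$, the extended binomial coefficient $\binom{k}{n}_{f}$ is the coefficient of $x^n$ in $\bigl(\sum_{s\in\mathbb{N}} f(s)x^s\bigr)^k$. The sum $\sum_{n\ge 0}\binom{k}{n}_{f}$ is the total number of $f$-weighted integer compositions with $k$ parts. *)

theory Defs
  imports
    "HOL-Computational_Algebra.Formal_Power_Series"
    "HOL-Computational_Algebra.Polynomial_FPS"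
    "HOL-Number_Theory.Cong"
begin

definition ext_binomial :: "(nat \<Rightarrow> nat) \<Rightarrow> nat \<Rightarrow> nat \<Rightarrow> nat" where
  "ext_binomial f k n = fps_nth (Abs_fps f ^ k) n"

text \<open>
  For the discrete topology on \<^typ>\<open>nat\<close>, the series of extended binomial coefficients of a
  finitely supported \<open>f\<close> has only finitely many nonzero terms. Hence it converges, and
  \<^const>\<open>suminf\<close> denotes its actual sum.
\<close>

lemma finite_support_ext_binomial:
  assumes "finite {s. f s \<noteq> 0}"
  shows "finite {n. ext_binomial f k n \<noteq> 0}"
proof -
  have "\<forall>\<^sub>\<infinity>s. f s = 0"
    using assms by (simp add: MOST_iff_cofinite)
  then have "Abs_fps f = fps_of_poly (Abs_poly f)"
    by (intro fps_ext) (simp add: Abs_poly_inverse)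
  then have "ext_binomial f k n = coeff (Abs_poly f ^ k) n" for n
    by (simp add: ext_binomial_def flip: fps_of_poly_power)
  then show ?thesis
    using MOST_coeff_eq_0[of "Abs_poly f ^ k"] by (simp add: eventually_cofinite)
qed

lemma ext_binomial_sums:
  assumes "finite {s. f s \<noteq> 0}"
  shows "ext_binomial f k sums (\<Sum>n | ext_binomial f k n \<noteq> 0. ext_binomial f k n)"
  using finite_support_ext_binomial[OF assms] by (intro sums_finite) auto

end

theory Submission
  imports Defs
begin

text \<open>The coefficients of a polynomial sum to its value at 1. Evaluating the
  \<open>k\<close>-th power of the generating polynomial of \<open>f\<close> at 1 therefore gives
  \<open>M ^ k\<close> (\<open>suminf_ext_binomial\<close>), and a positive power has the parity of
  its base.\<close>

lemma suminf_coeff_eq_poly_1: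
  fixes p :: "'a::{comm_semiring_1, topological_comm_monoid_add, t2_space} poly"
  shows "(\<Sum>n. coeff p n) = poly p 1"
proof -
  have "(\<Sum>n. coeff p n) = (\<Sum>n\<le>degree p. coeff p n)"
    by (rule suminf_finite) (auto simp: coeff_eq_0)
  then show ?thesis
    by (simp add: poly_altdef)
qed

text \<open>Finite support turns the power series of \<open>f\<close> into a polynomial, and
  evaluation at 1 commutes with powers.\<close>

lemma suminf_ext_binomial:
  assumes "finite {s. f s \<noteq> 0}"
  shows "(\<Sum>n. ext_binomial f k n) = (\<Sum>s. f s) ^ k"
proof -
  have "\<forall>\<^sub>\<infinity>s. f s = 0"
    using assms by (simp add: MOST_iff_cofinite)
  then have coeff: "coeff (Abs_poly f) = f"
    by (simp add: Abs_poly_inverse)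
  then have "Abs_fps f = fps_of_poly (Abs_poly f)"
    by (intro fps_ext) simp
  then have "ext_binomial f k = coeff (Abs_poly f ^ k)"
    by (simp add: fun_eq_iff ext_binomial_def flip: fps_of_poly_power)
  then show ?thesis
    \<comment> \<open>The first instance evaluates the base on the right-hand side, the second the
      left-hand side.\<close>
    using suminf_coeff_eq_poly_1[of "Abs_poly f"] suminf_coeff_eq_poly_1[of "Abs_poly f ^ k"]
    by (simp add: coeff)
qed

theorem theorem31:
  fixes f :: "nat \<Rightarrow> nat" and M k :: nat
  assumes "finite {s. f s \<noteq> 0}"
    and "M = (\<Sum>s. f s)"
    and "k > 0"
  shows "[(\<Sum>n. ext_binomial f k n) = M] (mod 2)"
proof -
  \<comment> \<open>This fails for \<open>k = 0\<close> and even \<open>M\<close>, where the power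
    is 1.\<close>
  have "even (M ^ k) \<longleftrightarrow> even M"
    using \<open>k > 0\<close> by simp
  then have "[M ^ k = M] (mod 2)"
    by (simp add: cong_def mod2_eq_if)
  then show ?thesis
    by (simp add: suminf_ext_binomial[OF assms(1)] assms(2))
qed

end
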